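(* Let $0<q<1$ and let $\nu>-1$ be real with $\nu\notin\{0,1,2,\dots\}$. Let $V:\mathbb{R}_q^+\to\mathbb{R}$ and $\lambda\in\mathbb{R}$, and assume there exist $a\in\mathbb{R}_q^+$ and $\delta>0$ such that $V(x)-\lambda>\delta$ for all $x\in\mathbb{R}_q^+$ with $x\ge a$. Let $f:\mathbb{R}_q^+\to\mathbb{R}$ be a solution, not identically zero, of the $q$-difference equation $$\Delta_{q,\nu}f(x)=[V(x)-\lambda]f(x),\qquad\forall x\in\mathbb{R}_q^+ .$$ Then either $\lim_{x\to\infty}f(x)=+\infty$ or $\lim_{x\to\infty}f(x)=-\infty$, or else $f(x)\ne0$ for $x$ big enough and $\int_a^\infty|f(x)|^2x^{2\nu+1}d_qx<\infty$. In the latter case, writing $f_n=f(q^{-n})$ and $\nu_n=q^{-\nu}f_n/f_{n-1}$ (when $f_{n-1}\neq0$), the following hold: (i) $\nu_n>0$ for $n$ big enough, and $\lim_{n\to\infty}\nu_n=0$. (ii) There exist $c,\sigma>0$ such that $|f_n|<\sigma c^nq^{n^2}$ for $n$ big enough.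
   Context: $\mathbb{R}_q^+=\{q^n:n\in\mathbb{Z}\}$; limits $x\to\infty$ are taken along $x\in\mathbb{R}_q^+$. The $q$-Bessel operator is $$\Delta_{q,\nu}f(x)=\frac{1}{x^2}\Big[f(q^{-1}x)-(1+q^{2\nu})f(x)+q^{2\nu}f(qx)\Big].$$ The Jackson integral is $\int_0^a f(x)d_qx=(1-q)a\sum_{n=0}^\infty q^nf(aq^n)$, $\int_0^\infty f(x)d_qx=(1-q)\sum_{n=-\infty}^\infty q^nf(q^n)$; accordingly, for $a\in\mathbb{R}_q^+$, $\int_a^\infty f(x)d_qx=(1-q)\sum_{x\in\mathbb{R}_q^+,\,x>a}xf(x)$. The number $\nu$ (no index) is the fixed parameter and the sequence $(\nu_n)$ is the one defined in the claim. *)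

theory Defs
  imports "HOL-Analysis.Analysis"
begin

definition q_half_line :: "real \<Rightarrow> real set" where
  "q_half_line q = range (\<lambda>n::int. q powi n)"

(* The filter of x tending to infinity along the points of the q-half-line only. *)
definition q_at_top :: "real \<Rightarrow> real filter" where
  "q_at_top q = inf at_top (principal (q_half_line q))"

(* Functions on the q-half-line are represented by functions on the reals; for x in the
   q-half-line all evaluation points below stay in the q-half-line. *)
definition q_bessel_op :: "real \<Rightarrow> real \<Rightarrow> (real \<Rightarrow> real) \<Rightarrow> real \<Rightarrow> real" where
  "q_bessel_op q \<nu> f x =
     1 / x\<^sup>2 * (f (x / q) - (1 + q powr (2 * \<nu>)) * f x + q powr (2 * \<nu>) * f (q * x))"

(* Jackson integral over (a, infinity) of a nonnegative function. It takes values in the extended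
   nonnegative reals, where every sum exists, so that being less than infinity expresses
   convergence. *)
definition jackson_nn_integral :: "real \<Rightarrow> real \<Rightarrow> (real \<Rightarrow> ennreal) \<Rightarrow> ennreal" where
  "jackson_nn_integral q a g =
     ennreal (1 - q) * (\<Sum>\<^sub>\<infinity>x\<in>{x \<in> q_half_line q. x > a}. ennreal x * g x)"

definition q_seq :: "real \<Rightarrow> (real \<Rightarrow> real) \<Rightarrow> int \<Rightarrow> real" where
  "q_seq q f n = f (q powi (- n))"

(* Only meaningful when the denominator is nonzero. *)
definition q_ratio :: "real \<Rightarrow> real \<Rightarrow> (real \<Rightarrow> real) \<Rightarrow> int \<Rightarrow> real" where
  "q_ratio q \<nu> f n = q powr (- \<nu>) * q_seq q f n / q_seq q f (n - 1)"

end

theory Submission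
  imports Defs
begin

text \<open>
  Along the points \<open>x\<^sub>k = a / q ^ k\<close> the equation is a three-term recurrence for \<open>u\<^sub>k = f x\<^sub>k\<close>,
  \<open>u\<^bsub>k+1\<^esub> - u\<^sub>k = x\<^sub>k\<^sup>2 (V x\<^sub>k - lam) u\<^sub>k + q\<^bsup>2\<nu>\<^esup> (u\<^sub>k - u\<^bsub>k-1\<^esub>)\<close>,
  whose first coefficient is positive and of order at least \<open>x\<^sub>k\<^sup>2\<close>. If at some step \<open>u\<close>, or \<open>- u\<close>,
  is positive and has not decreased, then both terms on the right are nonnegative, so from then on
  it increases at every step by at least a fixed amount, and \<open>f\<close> tends to \<open>\<plusminus>\<infinity>\<close>
  (\<open>filterlim_at_top_of_growing_step\<close>). If this never happens, then \<open>u\<close> has constant sign and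
  \<open>\<bar>u\<bar>\<close> decreases strictly (\<open>three_term_dichotomy\<close>). A zero cannot occur then: it would be followed
  by a nonzero value, which is a growing step, or by a second zero, which forces \<open>f = 0\<close>
  (\<open>q_bessel_equation_unique\<close>).

  In the decreasing case the left-hand side of the recurrence has the sign opposite to \<open>u\<close>, hence
  \<open>x\<^sub>k\<^sup>2 \<bar>u\<^sub>k\<bar> \<le> K \<bar>u\<^bsub>k-1\<^esub>\<bar>\<close> with \<open>K = q\<^bsup>2\<nu>\<^esup> / \<delta>\<close>. This estimate and the constant sign,
  called \<open>recessive\<close> below, contain the whole third alternative: successive quotients tend to \<open>0\<close>, so the integral converges
  by the ratio test; and as \<open>x = q\<^bsup>-n\<^esup>\<close> at index \<open>n\<close>, iterating
  \<open>\<bar>f\<^sub>n\<bar> \<le> K q\<^bsup>2n\<^esup> \<bar>f\<^bsub>n-1\<^esub>\<bar>\<close> gives the Gaussian bound. Conversely, a function tending to \<open>\<plusminus>\<infinity>\<close>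
  cannot be square integrable: the summands \<open>x\<^bsup>2\<nu>+2\<^esup> f(x)\<^sup>2\<close> do not tend to \<open>0\<close>, since
  \<open>2\<nu> + 2 > 0\<close>. So convergence of the integral leaves only the recessive case.
\<close>

section \<open>The q-half-line, its limits at infinity and the Jackson integral\<close>

lemma q_half_line_pos:
  assumes "0 < q" and "x \<in> q_half_line q"
  shows "x > 0"
  using assms by (auto simp: q_half_line_def)

lemma q_half_line_divide_power:
  assumes "0 < q" and "x \<in> q_half_line q"
  shows "x / q ^ k \<in> q_half_line q"
proof -
  obtain m :: int where "x = q powi m"
    using assms(2) by (auto simp: q_half_line_def)
  then have "x / q ^ k = q powi (m - int k)"
    using assms(1) by (simp add: power_int_diff)
  then show ?thesis by (simp add: q_half_line_def)
qed

text \<open>Together with the previous lemma: the geometric sequence of ratio \<open>1 / q\<close> from any point of the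
  half-line runs through all larger points. This turns limits and integrals into sequential ones.\<close>
lemma q_half_line_ge_imp_divide_power:
  assumes "0 < q" and "q < 1" and "a \<in> q_half_line q" and "x \<in> q_half_line q" and "a \<le> x"
  obtains k :: nat where "x = a / q ^ k"
proof -
  obtain m n :: int where m: "a = q powi m" and n: "x = q powi n"
    using assms(3,4) by (auto simp: q_half_line_def)
  have "n \<le> m"
  proof (rule ccontr)
    assume "\<not> n \<le> m"
    then have "q powi n < q powi m"
      using assms(1,2) by (intro power_int_strict_decreasing) auto
    then show False using assms(5) m n by simp
  qed
  then obtain k :: nat where k: "m - n = int k"
    using zero_le_imp_eq_int[of "m - n"] by auto
  have "x = q powi m / q powi int k"
    using assms(1) n by (simp add: power_int_diff[symmetric] k[symmetric] del: power_int_of_nat)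
  then have "x = a / q ^ k" using m by simp
  then show ?thesis by (rule that)
qed

lemma q_half_line_greaterThan_eq_range:
  assumes "0 < q" and "q < 1" and "a \<in> q_half_line q"
  shows "{x \<in> q_half_line q. x > a} = range (\<lambda>k. a / q ^ Suc k)"
proof (intro set_eqI iffI)
  fix x assume "x \<in> {x \<in> q_half_line q. x > a}"
  then have x: "x \<in> q_half_line q" "a < x" by auto
  obtain k where k: "x = a / q ^ k"
    using q_half_line_ge_imp_divide_power[OF assms x(1)] x(2) by auto
  then obtain j where "k = Suc j"
    using x(2) by (cases k) auto
  then show "x \<in> range (\<lambda>k. a / q ^ Suc k)" using k by blast
next
  fix x assume "x \<in> range (\<lambda>k. a / q ^ Suc k)"
  then obtain k where k: "x = a / q ^ Suc k" by blast
  have "a > 0" using assms q_half_line_pos by blast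
  moreover have "q ^ Suc k < 1" using assms by (intro power_Suc_less_one) auto
  ultimately have "a < x" using k assms by (simp add: less_divide_eq del: power_Suc)
  then show "x \<in> {x \<in> q_half_line q. x > a}"
    using k q_half_line_divide_power[OF assms(1,3)] by blast
qed

lemma filterlim_divide_power_at_top:
  fixes q a :: real
  assumes "0 < q" and "q < 1" and "a > 0"
  shows "filterlim (\<lambda>k. a / q ^ k) at_top sequentially"
proof -
  have "filterlim (\<lambda>k. (1 / q) ^ k) at_infinity sequentially"
    using assms by (intro filterlim_realpow_sequentially_gt1) simp
  then have "filterlim (\<lambda>k. (1 / q) ^ k) at_top sequentially"
    using assms by (intro filterlim_at_infinity_imp_filterlim_at_top) auto
  then have "filterlim (\<lambda>k. a * (1 / q) ^ k) at_top sequentially"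
    using assms by (intro filterlim_tendsto_pos_mult_at_top[OF tendsto_const]) auto
  then show ?thesis by (simp add: power_divide)
qed

text \<open>The starting point \<open>a\<close> is arbitrary. The recurrence is studied from the threshold \<open>a\<close> of the
  potential onwards, whereas the indexing of \<open>f\<^sub>n\<close> starts at \<open>1\<close>; passing through the filter avoids
  a shift of indices between the two.\<close>
lemma q_at_top_eq_filtermap:
  assumes "0 < q" and "q < 1" and "a \<in> q_half_line q"
  shows "q_at_top q = filtermap (\<lambda>k. a / q ^ k) sequentially"
proof (rule filter_eq_iff[THEN iffD2], intro allI iffI)
  have a: "a > 0" using assms q_half_line_pos by blast
  fix P :: "real \<Rightarrow> bool"
  {
    assume "eventually P (q_at_top q)"
    then have "\<forall>\<^sub>F x in at_top. x \<in> q_half_line q \<longrightarrow> P x"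
      by (simp add: q_at_top_def eventually_inf_principal)
    then have "\<forall>\<^sub>F k in sequentially. a / q ^ k \<in> q_half_line q \<longrightarrow> P (a / q ^ k)"
      using filterlim_divide_power_at_top[OF assms(1,2) a] by (auto simp: filterlim_iff)
    then show "eventually P (filtermap (\<lambda>k. a / q ^ k) sequentially)"
      using q_half_line_divide_power[OF assms(1,3)] by (simp add: eventually_filtermap)
  next
    assume "eventually P (filtermap (\<lambda>k. a / q ^ k) sequentially)"
    then obtain K where K: "\<And>k. k \<ge> K \<Longrightarrow> P (a / q ^ k)"
      by (auto simp: eventually_filtermap eventually_sequentially)
    have "P x" if x: "x \<ge> a / q ^ K" "x \<in> q_half_line q" for x
    proof -
      obtain j where "x = a / q ^ K / q ^ j"
        using q_half_line_ge_imp_divide_power[OF assms(1,2) q_half_line_divide_power[OF assms(1,3)] x(2,1)]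
        by blast
      then have "x = a / q ^ (K + j)" by (simp add: power_add)
      then show "P x" using K by simp
    qed
    then show "eventually P (q_at_top q)"
      by (auto simp: q_at_top_def eventually_inf_principal eventually_at_top_linorder)
  }
qed

lemma jackson_nn_integral_finite_iff_summable:
  assumes "0 < q" and "q < 1" and "a \<in> q_half_line q" and "\<And>x. h x \<ge> 0"
  shows "jackson_nn_integral q a (\<lambda>x. ennreal (h x)) < \<infinity> \<longleftrightarrow>
    summable (\<lambda>k. a / q ^ Suc k * h (a / q ^ Suc k))"
proof -
  define t where "t = (\<lambda>k. a / q ^ Suc k * h (a / q ^ Suc k))"
  have a: "a > 0" using assms q_half_line_pos by blast
  have t: "t k \<ge> 0" for k using a assms by (simp add: t_def)
  have "inj (\<lambda>k. a / q ^ Suc k)"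
    using a assms by (auto simp: inj_on_def power_inject_exp')
  then have "(\<Sum>\<^sub>\<infinity>x\<in>{x \<in> q_half_line q. x > a}. ennreal x * ennreal (h x)) =
      (\<Sum>\<^sub>\<infinity>k. ennreal (a / q ^ Suc k) * ennreal (h (a / q ^ Suc k)))"
    by (simp add: q_half_line_greaterThan_eq_range[OF assms(1-3)] infsum_reindex o_def)
  also have "\<dots> = (\<Sum>\<^sub>\<infinity>k. ennreal (t k))"
    using a assms by (simp only: t_def ennreal_mult divide_nonneg_nonneg zero_le_power less_imp_le)
  also have "\<dots> = (\<Sum>k. ennreal (t k))"
    by (intro sums_unique has_sum_imp_sums has_sum_infsum nonneg_summable_on_complete) simp
  finally have "jackson_nn_integral q a (\<lambda>x. ennreal (h x)) = ennreal (1 - q) * (\<Sum>k. ennreal (t k))"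
    by (simp add: jackson_nn_integral_def)
  moreover have "ennreal (1 - q) * s < \<infinity> \<longleftrightarrow> s < \<infinity>" for s
    using assms(2) by (cases "s = 0") (simp_all add: ennreal_mult_less_top)
  moreover have "(\<Sum>k. ennreal (t k)) < \<infinity> \<longleftrightarrow> summable t"
    unfolding infinity_ennreal_def less_top[symmetric]
    using summable_suminf_not_top[of t] ennreal_suminf_neq_top[of t] t by blast
  ultimately show ?thesis by (simp add: t_def)
qed

section \<open>The three-term recurrence\<close>

lemma q_bessel_equation_imp_recurrence:
  assumes "0 < q" and "x \<in> q_half_line q" and "q_bessel_op q \<nu> f x = W * f x"
  shows "f (x / q) - f x = x\<^sup>2 * W * f x + q powr (2 * \<nu>) * (f x - f (q * x))"
proof -
  have "x \<noteq> 0" using q_half_line_pos[OF assms(1,2)] by simp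
  then show ?thesis
    using assms(3) by (simp add: q_bessel_op_def field_simps)
qed

text \<open>The recurrence can be run in both directions, towards smaller points because
  \<open>q\<^bsup>2\<nu>\<^esup> \<noteq> 0\<close>. Two neighbouring zeros therefore spread over the whole half-line.\<close>
lemma q_bessel_equation_unique:
  assumes "0 < q"
    and eq: "\<And>x. x \<in> q_half_line q \<Longrightarrow> q_bessel_op q \<nu> f x = W x * f x"
    and x: "x \<in> q_half_line q" "f x = 0" "f (q * x) = 0"
    and y: "y \<in> q_half_line q"
  shows "f y = 0"
proof -
  obtain m :: int where m: "x = q powi m" using x(1) by (auto simp: q_half_line_def)
  obtain n :: int where n: "y = q powi n" using y by (auto simp: q_half_line_def)
  have rec: "f (q powi (k - 1)) - f (q powi k) =
      (q powi k)\<^sup>2 * W (q powi k) * f (q powi k) +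
      q powr (2 * \<nu>) * (f (q powi k) - f (q powi (k + 1)))" for k
  proof -
    have "q powi k / q = q powi (k - 1)" "q * q powi k = q powi (k + 1)"
      using assms(1) by (auto simp: power_int_diff power_int_add)
    then show ?thesis
      using q_bessel_equation_imp_recurrence[OF assms(1) _ eq, of "q powi k"]
      by (auto simp: q_half_line_def)
  qed
  have "f (q powi n) = 0 \<and> f (q powi (n + 1)) = 0"
  proof (induction n rule: int_induct[where k = m])
    case base
    have "q * q powi m = q powi (m + 1)" using assms(1) by (simp add: power_int_add)
    then show ?case using x m by simp
  next
    case (step1 i)
    have "q powr (2 * \<nu>) \<noteq> 0" using assms(1) by simp
    then show ?case using rec[of "i + 1"] step1 by simp
  next
    case (step2 i)
    then show ?case using rec[of i] by simp
  qed
  then show ?thesis using n by simp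
qed

text \<open>Positivity and a nonnegative increment are inherited by the next step, and the lower bound \<open>d\<close>
  on the coefficient makes each further increment at least \<open>d\<close> times the first value.\<close>
lemma filterlim_at_top_of_growing_step:
  fixes u A :: "nat \<Rightarrow> real"
  assumes "d > 0" and "B \<ge> 0" and A: "\<And>k. A k \<ge> d"
    and rec: "\<And>k. u (Suc (Suc k)) - u (Suc k) = A (Suc k) * u (Suc k) + B * (u (Suc k) - u k)"
    and k: "u (Suc k) > 0" "u (Suc k) \<ge> u k"
  shows "filterlim u at_top sequentially"
proof -
  define c where "c = d * u (Suc k)"
  have "c > 0" using assms(1) k by (simp add: c_def)
  have step: "u (Suc (Suc j)) \<ge> u (Suc j) + d * u (Suc j)"
    if "u (Suc j) > 0" "u (Suc j) \<ge> u j" for j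
  proof -
    have "d * u (Suc j) \<le> A (Suc j) * u (Suc j)"
      using A that by (intro mult_right_mono) auto
    moreover have "0 \<le> B * (u (Suc j) - u j)" using assms(2) that by simp
    ultimately show ?thesis using rec[of j] by simp
  qed
  have *: "u (Suc (k + j)) \<ge> u (Suc k) + real j * c \<and> u (Suc (k + j)) \<ge> u (k + j)" for j
  proof (induction j)
    case 0
    then show ?case using k by simp
  next
    case (Suc j)
    have ge: "u (Suc (k + j)) \<ge> u (Suc k)"
      using Suc \<open>c > 0\<close> by (smt (verit) mult_nonneg_nonneg of_nat_0_le_iff)
    then have "d * u (Suc (k + j)) \<ge> c"
      using assms(1) by (simp add: c_def)
    moreover have "u (Suc (Suc (k + j))) \<ge> u (Suc (k + j)) + d * u (Suc (k + j))"
      using step[of "k + j"] Suc ge k by simp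
    ultimately show ?case using Suc \<open>c > 0\<close> by (simp add: algebra_simps)
  qed
  have "filterlim (\<lambda>j. u (Suc k) + c * real j) at_top sequentially"
    using \<open>c > 0\<close>
    by (intro filterlim_tendsto_add_at_top[OF tendsto_const]
        filterlim_tendsto_pos_mult_at_top[OF tendsto_const] filterlim_real_sequentially) auto
  then have "filterlim (\<lambda>j. u (j + Suc k)) at_top sequentially"
    by (rule filterlim_at_top_mono)
      (use * in \<open>auto simp: algebra_simps\<close>)
  then show ?thesis
    by (simp add: filterlim_iff eventually_sequentially_seg[of "\<lambda>j. P (u j)" "Suc k" for P] del: add_Suc_right)
qed

text \<open>The factor \<open>s\<close> treats \<open>u\<close> and \<open>- u\<close> at once. If there is no growing step, then a zero
  \<open>u (Suc k)\<close> would give \<open>u (Suc (Suc k)) = - B * u k \<noteq> 0\<close>, and a change of sign would put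
  \<open>s * u (Suc k)\<close> above \<open>0\<close> after a negative value; both are growing steps for one of the two signs.\<close>
lemma three_term_dichotomy:
  fixes u A :: "nat \<Rightarrow> real"
  assumes "B > 0"
    and rec: "\<And>k. u (Suc (Suc k)) - u (Suc k) = A (Suc k) * u (Suc k) + B * (u (Suc k) - u k)"
    and nz: "\<And>k. u k \<noteq> 0 \<or> u (Suc k) \<noteq> 0"
  obtains (grow) s k where "s \<in> {1, -1}" "s * u (Suc k) > 0" "s * u (Suc k) \<ge> s * u k"
  | (decay) s where "s \<in> {1, -1}" "\<And>k. s * u k > 0" "\<And>k. s * u (Suc k) < s * u k"
proof -
  consider (grow') s k where "s \<in> {1, -1::real}" "s * u (Suc k) > 0" "s * u (Suc k) \<ge> s * u k"
    | (not) "\<And>s k. s \<in> {1, -1} \<Longrightarrow> s * u (Suc k) > 0 \<Longrightarrow> s * u (Suc k) < s * u k"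
    by (meson not_le)
  then show ?thesis
  proof cases
    case grow'
    then show ?thesis using grow by blast
  next
    case not
    have nz': "u (Suc k) \<noteq> 0" for k
    proof
      assume z: "u (Suc k) = 0"
      then have "u k \<noteq> 0" using nz[of k] by simp
      moreover have "u (Suc (Suc k)) = - B * u k" using rec[of k] z by simp
      ultimately have "u (Suc (Suc k)) \<noteq> 0" using assms(1) by simp
      then show False using not[of 1 "Suc k"] not[of "-1" "Suc k"] z by (cases "u (Suc (Suc k)) > 0") auto
    qed
    define s where "s = sgn (u 1)"
    have s: "s \<in> {1, -1}" using nz'[of 0] by (auto simp: s_def sgn_if)
    have "s * u (Suc k) > 0" for k
    proof (induction k)
      case 0
      show ?case using nz'[of 0] by (simp add: s_def sgn_if)
    next
      case (Suc k)
      show ?case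
      proof (rule ccontr)
        assume "\<not> s * u (Suc (Suc k)) > 0"
        then have "- s * u (Suc (Suc k)) > 0"
          using nz'[of "Suc k"] s by auto
        then have "- s * u (Suc (Suc k)) < - s * u (Suc k)" using not[of "-s"] s by force
        then show False using Suc \<open>- s * u (Suc (Suc k)) > 0\<close> by simp
      qed
    qed
    note pos = this
    have dec: "s * u (Suc k) < s * u k" for k using not[OF s pos] .
    have "s * u k > 0" for k
      using pos[of k] dec[of k] by simp
    then show ?thesis using decay s dec by blast
  qed
qed

section \<open>Recessive functions\<close>

text \<open>The behaviour at infinity of the subdominant (minimal) solution. The constant \<open>K\<close> is left free
  because only the order \<open>x\<^sup>2\<close> matters.\<close>
definition recessive :: "real \<Rightarrow> (real \<Rightarrow> real) \<Rightarrow> bool" where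
  "recessive q f \<longleftrightarrow>
    (\<exists>K>0. \<forall>\<^sub>F x in q_at_top q. f x * f (q * x) > 0 \<and> x\<^sup>2 * \<bar>f x\<bar> \<le> K * \<bar>f (q * x)\<bar>)"

text \<open>In the decreasing case \<open>u\<^bsub>k+2\<^esub> - u\<^bsub>k+1\<^esub>\<close> and \<open>- B u\<^bsub>k+1\<^esub>\<close> have the sign opposite to \<open>u\<close>. Dropping them
  from the recurrence leaves \<open>A\<^bsub>k+1\<^esub> \<bar>u\<^bsub>k+1\<^esub>\<bar> \<le> B \<bar>u\<^sub>k\<bar>\<close>, where \<open>A\<^bsub>k+1\<^esub> \<ge> \<delta> x\<^bsub>k+1\<^esub>\<^sup>2\<close>.\<close>
lemma q_bessel_solution_dichotomy:
  fixes q \<nu> \<delta> a :: real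
  assumes q: "0 < q" "q < 1" and a: "a \<in> q_half_line q" and "\<delta> > 0"
    and W: "\<And>x. x \<in> q_half_line q \<Longrightarrow> x \<ge> a \<Longrightarrow> W x > \<delta>"
    and eq: "\<And>x. x \<in> q_half_line q \<Longrightarrow> q_bessel_op q \<nu> f x = W x * f x"
    and nz: "\<exists>x\<in>q_half_line q. f x \<noteq> 0"
  shows "filterlim f at_top (q_at_top q) \<or> filterlim f at_bot (q_at_top q) \<or> recessive q f"
proof -
  define x where "x = (\<lambda>k::nat. a / q ^ k)"
  define B where "B = q powr (2 * \<nu>)"
  define u where "u = (\<lambda>k. f (x k))"
  define A where "A = (\<lambda>k. (x k)\<^sup>2 * W (x k))"
  have a0: "a > 0" using q a q_half_line_pos by blast
  have B: "B > 0" using q by (simp add: B_def)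
  have xq: "x k \<in> q_half_line q" for k
    using q_half_line_divide_power[OF q(1) a] by (simp add: x_def)
  have xa: "a \<le> x k" for k
    using q a0 by (simp add: x_def divide_simps mult_le_cancel_left2 power_le_one)
  have x_Suc: "x k / q = x (Suc k)" "q * x (Suc k) = x k" for k
    using q by (auto simp: x_def)
  have flt: "q_at_top q = filtermap x sequentially"
    unfolding x_def by (rule q_at_top_eq_filtermap[OF q a])
  have rec: "u (Suc (Suc k)) - u (Suc k) = A (Suc k) * u (Suc k) + B * (u (Suc k) - u k)" for k
    using q_bessel_equation_imp_recurrence[OF q(1) xq[of "Suc k"] eq[OF xq[of "Suc k"]]]
    by (simp add: x_Suc u_def A_def B_def)
  have "u k \<noteq> 0 \<or> u (Suc k) \<noteq> 0" for k
    using q_bessel_equation_unique[OF q(1) eq xq, of "Suc k"] nz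
    by (auto simp: x_Suc u_def)
  from B rec this show ?thesis
  proof (cases rule: three_term_dichotomy[of B u A])
    case (grow s k)
    have A: "A k \<ge> a\<^sup>2 * \<delta>" for k
      unfolding A_def using xa[of k] W[OF xq xa, of k] a0 \<open>\<delta> > 0\<close>
      by (intro mult_mono power_mono) auto
    have "filterlim (\<lambda>k. s * u k) at_top sequentially"
    proof (rule filterlim_at_top_of_growing_step[where A = A and B = B and d = "a\<^sup>2 * \<delta>" and k = k])
      show "s * u (Suc (Suc k)) - s * u (Suc k) =
          A (Suc k) * (s * u (Suc k)) + B * (s * u (Suc k) - s * u k)" for k
        using arg_cong[OF rec[of k], of "\<lambda>z. s * z"] by (simp add: algebra_simps)
    qed (use grow A B a0 \<open>\<delta> > 0\<close> in auto)
    then have "filterlim (\<lambda>y. s * f y) at_top (q_at_top q)"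
      by (simp add: flt filterlim_filtermap u_def)
    then show ?thesis using grow(1) by (auto simp: filterlim_uminus_at_top)
  next
    case (decay s)
    have sgn1: "u (Suc k) * u k > 0" for k
      using decay(2)[of k] decay(2)[of "Suc k"] decay(1) by (auto simp: mult_neg_neg)
    have abs_u: "\<bar>u k\<bar> = s * u k" for k
      using decay(1) decay(2)[of k] by auto
    have "(x (Suc k))\<^sup>2 * \<bar>u (Suc k)\<bar> \<le> B / \<delta> * \<bar>u k\<bar>" for k
    proof -
      have "A (Suc k) * (s * u (Suc k)) =
          s * u (Suc (Suc k)) - s * u (Suc k) - B * (s * u (Suc k)) + B * (s * u k)"
        using arg_cong[OF rec[of k], of "\<lambda>z. s * z"] by (simp add: algebra_simps)
      also have "\<dots> \<le> B * (s * u k)"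
        using decay(3)[of "Suc k"] B decay(2)[of "Suc k"] mult_pos_pos[OF B decay(2)[of "Suc k"]] by linarith
      finally have "A (Suc k) * \<bar>u (Suc k)\<bar> \<le> B * \<bar>u k\<bar>" by (simp add: abs_u)
      moreover have "(x (Suc k))\<^sup>2 * \<delta> * \<bar>u (Suc k)\<bar> \<le> A (Suc k) * \<bar>u (Suc k)\<bar>"
        unfolding A_def using W[OF xq xa, of "Suc k"] by (intro mult_right_mono mult_left_mono) auto
      ultimately show ?thesis using \<open>\<delta> > 0\<close> by (simp add: field_simps)
    qed
    then have "\<forall>k\<ge>1. f (x k) * f (q * x k) > 0 \<and>
        (x k)\<^sup>2 * \<bar>f (x k)\<bar> \<le> B / \<delta> * \<bar>f (q * x k)\<bar>"
      using sgn1 by (auto simp: u_def x_Suc Suc_le_eq gr0_conv_Suc)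
    then have "recessive q f"
      unfolding recessive_def flt eventually_filtermap eventually_sequentially
      using B \<open>\<delta> > 0\<close> by (intro exI[of _ "B / \<delta>"]) auto
    then show ?thesis by blast
  qed
qed

lemma filterlim_q_at_top: "filterlim (\<lambda>x. x) at_top (q_at_top q)"
  by (simp add: q_at_top_def filterlim_def le_infI1)

lemma recessive_imp_small_ratio:
  assumes "0 < q" "recessive q f" "\<epsilon> > 0"
  shows "\<forall>\<^sub>F x in q_at_top q. \<bar>f x\<bar> \<le> \<epsilon> * \<bar>f (q * x)\<bar>"
proof -
  obtain K where K: "K > 0"
    "\<forall>\<^sub>F x in q_at_top q. f x * f (q * x) > 0 \<and> x\<^sup>2 * \<bar>f x\<bar> \<le> K * \<bar>f (q * x)\<bar>"
    using assms(2) by (auto simp: recessive_def)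
  have "\<forall>\<^sub>F x in q_at_top q. x \<ge> max 1 (K / \<epsilon>)"
    using filterlim_q_at_top unfolding filterlim_at_top by blast
  with K(2) show ?thesis
  proof eventually_elim
    case (elim x)
    have "K / \<epsilon> \<le> x * 1" using elim by simp
    also have "\<dots> \<le> x * x" using elim by (intro mult_left_mono) auto
    finally have "K / \<epsilon> * \<bar>f x\<bar> \<le> x\<^sup>2 * \<bar>f x\<bar>"
      by (intro mult_right_mono) (auto simp: power2_eq_square)
    also have "\<dots> \<le> K * \<bar>f (q * x)\<bar>" using elim by simp
    finally show ?case using K(1) assms(3) by (simp add: field_simps)
  qed
qed

text \<open>From one point to the next the weight grows by a fixed factor \<open>C\<close>, while the quotient of values
  is eventually below any \<open>\<epsilon>\<close>. With \<open>\<epsilon>\<^sup>2 = 1 / (2 C)\<close> the ratio test applies with constant \<open>1/2\<close>.\<close>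
lemma recessive_imp_square_integrable:
  assumes q: "0 < q" "q < 1" and a: "a \<in> q_half_line q" and rec: "recessive q f"
  shows "jackson_nn_integral q a (\<lambda>x. ennreal (\<bar>f x\<bar>\<^sup>2 * x powr p)) < \<infinity>"
proof -
  define x where "x = (\<lambda>k::nat. a / q ^ Suc k)"
  define C where "C = 1 / q * (1 / q) powr p"
  define t where "t = (\<lambda>k. x k * (\<bar>f (x k)\<bar>\<^sup>2 * x k powr p))"
  have C: "C > 0" using q by (simp add: C_def)
  have "a > 0" using q a q_half_line_pos by blast
  then have x0: "x k > 0" for k using q by (simp add: x_def)
  have x_Suc: "x (Suc k) = x k / q" for k by (simp add: x_def)
  have flt: "q_at_top q = filtermap x sequentially"
    using q_at_top_eq_filtermap[OF q q_half_line_divide_power[OF q(1) a, of 1]]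
    by (simp add: x_def mult.commute)
  define \<epsilon> where "\<epsilon> = sqrt (1 / (2 * C))"
  have e: "\<epsilon> > 0" "\<epsilon>\<^sup>2 = 1 / (2 * C)" using C by (auto simp: \<epsilon>_def)
  have "\<forall>\<^sub>F k in sequentially. \<bar>f (x k)\<bar> \<le> \<epsilon> * \<bar>f (q * x k)\<bar>"
    using recessive_imp_small_ratio[OF q(1) rec e(1)] by (simp add: flt eventually_filtermap)
  then obtain N where N: "\<And>k. k \<ge> N \<Longrightarrow> \<bar>f (x k)\<bar> \<le> \<epsilon> * \<bar>f (q * x k)\<bar>"
    by (auto simp: eventually_sequentially)
  have "summable t"
  proof (rule summable_ratio_test[where c = "1/2" and N = N])
    fix k assume "k \<ge> N"
    then have "\<bar>f (x (Suc k))\<bar> \<le> \<epsilon> * \<bar>f (x k)\<bar>"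
      using N[of "Suc k"] q by (simp add: x_Suc)
    then have "\<bar>f (x (Suc k))\<bar>\<^sup>2 \<le> (\<epsilon> * \<bar>f (x k)\<bar>)\<^sup>2" by (intro power_mono) auto
    also have "\<dots> = 1 / (2 * C) * \<bar>f (x k)\<bar>\<^sup>2" by (simp add: power_mult_distrib e)
    finally have *: "\<bar>f (x (Suc k))\<bar>\<^sup>2 \<le> 1 / (2 * C) * \<bar>f (x k)\<bar>\<^sup>2" .
    have "x k powr p / q powr p = (1 / q) powr p * x k powr p"
      using q x0[of k] by (simp add: powr_divide)
    then have "t (Suc k) = C * x k * x k powr p * \<bar>f (x (Suc k))\<bar>\<^sup>2"
      using q x0[of k] by (simp add: t_def C_def x_Suc powr_divide)
    also have "\<dots> \<le> C * x k * x k powr p * (1 / (2 * C) * \<bar>f (x k)\<bar>\<^sup>2)"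
      using C x0[of k] by (intro mult_left_mono *) auto
    also have "\<dots> = 1 / 2 * t k" using C by (simp add: t_def)
    finally show "norm (t (Suc k)) \<le> 1 / 2 * norm (t k)"
      using x0[of k] x0[of "Suc k"] by (simp add: t_def)
  qed simp
  then show ?thesis
    by (subst jackson_nn_integral_finite_iff_summable[OF q a]) (simp_all add: t_def x_def)
qed

text \<open>The integral is a sum of \<open>x\<^bsup>p+1\<^esup> f(x)\<^sup>2\<close>, and for \<open>p \<ge> -1\<close> these terms are at least \<open>1\<close>
  as soon as \<open>x\<close> and \<open>\<bar>f x\<bar>\<close> are.\<close>
lemma square_integrable_imp_not_unbounded:
  assumes q: "0 < q" "q < 1" and a: "a \<in> q_half_line q" and "p \<ge> -1"
    and fin: "jackson_nn_integral q a (\<lambda>x. ennreal (\<bar>f x\<bar>\<^sup>2 * x powr p)) < \<infinity>"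
  shows "\<not> filterlim f at_infinity (q_at_top q)"
proof
  assume "filterlim f at_infinity (q_at_top q)"
  then have "\<forall>\<^sub>F x in q_at_top q. 1 \<le> \<bar>f x\<bar>"
    unfolding filterlim_at_infinity[OF order.refl] real_norm_def by (meson zero_less_one)
  moreover have "\<forall>\<^sub>F x in q_at_top q. x \<ge> 1"
    using filterlim_q_at_top unfolding filterlim_at_top by blast
  ultimately have ev: "\<forall>\<^sub>F x in q_at_top q. 1 \<le> x * (\<bar>f x\<bar>\<^sup>2 * x powr p)"
  proof eventually_elim
    case (elim x)
    have "1 * 1 \<le> \<bar>f x\<bar>\<^sup>2 * x powr (1 + p)"
      using elim \<open>p \<ge> -1\<close> by (intro mult_mono one_le_power ge_one_powr_ge_zero) auto
    then show ?case using elim by (simp add: powr_add mult_ac)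
  qed
  define t where "t = (\<lambda>k. a / q ^ Suc k * (\<bar>f (a / q ^ Suc k)\<bar>\<^sup>2 * (a / q ^ Suc k) powr p))"
  have "summable t"
    using fin jackson_nn_integral_finite_iff_summable[OF q a, of "\<lambda>x. \<bar>f x\<bar>\<^sup>2 * x powr p"]
    by (simp add: t_def)
  then have "t \<longlonglongrightarrow> 0" by (rule summable_LIMSEQ_zero)
  then have "\<forall>\<^sub>F k in sequentially. t k < 1" by (rule order_tendstoD) simp
  moreover have "\<forall>\<^sub>F k in sequentially. 1 \<le> t k"
    using ev q_at_top_eq_filtermap[OF q q_half_line_divide_power[OF q(1) a, of 1]]
    by (simp add: eventually_filtermap t_def mult.commute)
  ultimately have "\<forall>\<^sub>F k::nat in sequentially. False" by eventually_elim simp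
  then show False by simp
qed

section \<open>The sequence of values and its quotients\<close>

text \<open>The indices \<open>n\<close> and \<open>n - 1\<close> belong to the points \<open>x\<close> and \<open>q x\<close> with \<open>x = q\<^bsup>-n\<^esup>\<close>, so each
  defining estimate of a recessive function becomes one about consecutive \<open>f\<^sub>n\<close>.\<close>
lemma eventually_q_seq_of_q_at_top:
  assumes q: "0 < q" "q < 1" and ev: "\<forall>\<^sub>F x in q_at_top q. P x (f x) (f (q * x))"
  shows "\<forall>\<^sub>F n :: nat in sequentially. P (1 / q ^ n) (q_seq q f (int n)) (q_seq q f (int n - 1))"
proof -
  have one: "1 \<in> q_half_line q" unfolding q_half_line_def by (rule range_eqI[of _ _ 0]) simp
  have "\<forall>\<^sub>F n in sequentially. P (1 / q ^ n) (f (1 / q ^ n)) (f (q * (1 / q ^ n)))"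
    using ev unfolding q_at_top_eq_filtermap[OF q one] eventually_filtermap .
  moreover have "q_seq q f (int n) = f (1 / q ^ n)" for n
    using q by (simp add: q_seq_def power_int_minus divide_simps)
  moreover have "q_seq q f (int n - 1) = f (q * (1 / q ^ n))" for n
    using q by (simp add: q_seq_def power_int_diff)
  ultimately show ?thesis by (simp only:)
qed

lemma recessive_imp_q_ratio_tendsto_0:
  assumes q: "0 < q" "q < 1" and rec: "recessive q f"
  shows "(\<lambda>n. q_ratio q \<nu> f (int n)) \<longlonglongrightarrow> 0"
proof -
  have qr: "q powr (- \<nu>) > 0" using q by simp
  have "\<forall>\<^sub>F n in sequentially. \<bar>q_ratio q \<nu> f (int n)\<bar> < e" if "e > 0" for e
  proof -
    define \<epsilon> where "\<epsilon> = e / (2 * q powr (- \<nu>))"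
    have eps: "\<epsilon> > 0" using that qr by (simp add: \<epsilon>_def)
    from eventually_q_seq_of_q_at_top[OF q, where P = "\<lambda>x y z. \<bar>y\<bar> \<le> \<epsilon> * \<bar>z\<bar>",
        OF recessive_imp_small_ratio[OF q(1) rec eps]]
    show ?thesis
    proof eventually_elim
      case (elim n)
      have "\<bar>q_seq q f (int n)\<bar> / \<bar>q_seq q f (int n - 1)\<bar> \<le> \<epsilon>"
        using elim eps by (cases "q_seq q f (int n - 1) = 0") (auto simp: divide_simps)
      then have "q powr (- \<nu>) * (\<bar>q_seq q f (int n)\<bar> / \<bar>q_seq q f (int n - 1)\<bar>) \<le> q powr (- \<nu>) * \<epsilon>"
        using qr by (intro mult_left_mono) auto
      also have "\<dots> = e / 2" using q by (simp add: \<epsilon>_def)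
      also have "\<dots> < e" using that by simp
      finally show ?case by (simp add: q_ratio_def abs_mult)
    qed
  qed
  then show ?thesis by (simp add: tendsto_iff)
qed

text \<open>The comparison sequence \<open>g\<^sub>n = K\<^sup>n q\<^bsup>n\<^sup>2\<^esup>\<close> has quotients \<open>K q\<^bsup>2n-1\<^esup>\<close>, which exceed the quotient
  bound \<open>K q\<^bsup>2n\<^esup>\<close> of \<open>\<bar>f\<^sub>n\<bar>\<close> by the factor \<open>1/q > 1\<close>. Hence \<open>\<bar>f\<^sub>n\<bar> / g\<^sub>n\<close> does not increase.\<close>
lemma recessive_imp_gaussian_decay:
  assumes q: "0 < q" "q < 1" and rec: "recessive q f"
  shows "\<exists>c > 0. \<exists>\<sigma> > 0. \<forall>\<^sub>F n :: nat in sequentially.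
         \<bar>q_seq q f (int n)\<bar> < \<sigma> * c ^ n * q ^ (n\<^sup>2)"
proof -
  obtain K where K: "K > 0"
    "\<forall>\<^sub>F x in q_at_top q. f x * f (q * x) > 0 \<and> x\<^sup>2 * \<bar>f x\<bar> \<le> K * \<bar>f (q * x)\<bar>"
    using rec by (auto simp: recessive_def)
  define F where "F = (\<lambda>n::nat. \<bar>q_seq q f (int n)\<bar>)"
  have "\<forall>\<^sub>F x in q_at_top q. x\<^sup>2 * \<bar>f x\<bar> \<le> K * \<bar>f (q * x)\<bar>"
    using K(2) by eventually_elim simp
  from eventually_q_seq_of_q_at_top[OF q, where P = "\<lambda>x y z. x\<^sup>2 * \<bar>y\<bar> \<le> K * \<bar>z\<bar>", OF this]
  obtain N :: nat where N:
    "\<And>n. n \<ge> N \<Longrightarrow> (1 / q ^ n)\<^sup>2 * \<bar>q_seq q f (int n)\<bar> \<le> K * \<bar>q_seq q f (int n - 1)\<bar>"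
    by (auto simp: eventually_sequentially)
  define g where "g = (\<lambda>n. K ^ n * q ^ (n\<^sup>2))"
  have g: "g n > 0" for n using K q by (simp add: g_def)
  have g_Suc: "g (Suc n) * q = K * (q ^ Suc n)\<^sup>2 * g n" for n
    by (simp add: g_def power2_eq_square power_add power_mult_distrib algebra_simps flip: power_mult)
  define M where "M = F N / g N"
  have M: "M \<ge> 0" using g[of N] by (simp add: M_def F_def)
  have "F n \<le> M * g n" if "n \<ge> N" for n
    using that
  proof (induction n rule: dec_induct)
    case base
    show ?case using g[of N] by (simp add: M_def)
  next
    case (step n)
    have "F (Suc n) \<le> K * (q ^ Suc n)\<^sup>2 * F n"
      using N[of "Suc n"] step(1) q by (simp add: F_def power_divide divide_simps mult_ac del: power_Suc)
    also have "\<dots> \<le> K * (q ^ Suc n)\<^sup>2 * (M * g n)"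
      using step.IH K by (intro mult_left_mono) auto
    also have "\<dots> = M * g (Suc n) * q"
      unfolding mult.assoc[of M] g_Suc by (simp only: mult.left_commute)
    also have "\<dots> \<le> M * g (Suc n) * 1"
      using q M g[of "Suc n"] by (intro mult_left_mono) auto
    finally show ?case by simp
  qed
  moreover have "M * g n < (M + 1) * g n" for n using g[of n] by simp
  ultimately have "\<forall>n\<ge>N. F n < (M + 1) * g n"
    using le_less_trans by blast
  then have "\<forall>n\<ge>N. F n < (M + 1) * K ^ n * q ^ (n\<^sup>2)"
    by (simp add: g_def mult.assoc)
  then show ?thesis
    using K(1) M unfolding F_def eventually_sequentially
    by (intro exI[of _ K] exI[of _ "M + 1"] conjI) auto
qed

theorem theorem4:
  fixes q \<nu> lam a \<delta> :: real and V f :: "real \<Rightarrow> real"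
  assumes "0 < q" and "q < 1"
    and "\<nu> > -1" and "\<nu> \<notin> \<nat>"
    and "a \<in> q_half_line q" and "\<delta> > 0"
    and "\<And>x. x \<in> q_half_line q \<Longrightarrow> x \<ge> a \<Longrightarrow> V x - lam > \<delta>"
    and "\<And>x. x \<in> q_half_line q \<Longrightarrow> q_bessel_op q \<nu> f x = (V x - lam) * f x"
    and "\<exists>x\<in>q_half_line q. f x \<noteq> 0"
  defines "third_case \<equiv> (\<forall>\<^sub>F x in q_at_top q. f x \<noteq> 0) \<and>
      jackson_nn_integral q a (\<lambda>x. ennreal (\<bar>f x\<bar>\<^sup>2 * x powr (2 * \<nu> + 1))) < \<infinity>"
  shows "(filterlim f at_top (q_at_top q) \<or> filterlim f at_bot (q_at_top q) \<or> third_case) \<and>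
    (third_case \<longrightarrow>
      (\<forall>\<^sub>F n :: nat in sequentially.
         q_seq q f (int n - 1) \<noteq> 0 \<and> q_ratio q \<nu> f (int n) > 0) \<and>
      (\<lambda>n. q_ratio q \<nu> f (int n)) \<longlonglongrightarrow> 0 \<and>
      (\<exists>c > 0. \<exists>\<sigma> > 0. \<forall>\<^sub>F n :: nat in sequentially.
         \<bar>q_seq q f (int n)\<bar> < \<sigma> * c ^ n * q ^ (n\<^sup>2)))"
proof -
  let ?W = "\<lambda>x. V x - lam"
  have trichotomy: "filterlim f at_top (q_at_top q) \<or> filterlim f at_bot (q_at_top q) \<or> recessive q f"
    by (rule q_bessel_solution_dichotomy[where W = ?W and \<delta> = \<delta> and a = a and \<nu> = \<nu>])
      (use assms in auto)
  have third: "third_case" if "recessive q f"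
  proof -
    have "\<forall>\<^sub>F x in q_at_top q. f x \<noteq> 0"
      using that by (auto simp: recessive_def elim!: eventually_mono)
    then show ?thesis
      unfolding third_case_def using recessive_imp_square_integrable[OF assms(1,2,5) that] by blast
  qed
  have recessive: "recessive q f" if third_case
  proof -
    have "\<not> filterlim f at_infinity (q_at_top q)"
      using square_integrable_imp_not_unbounded[OF assms(1,2,5), of "2 * \<nu> + 1"] that \<open>\<nu> > -1\<close>
      by (simp add: third_case_def)
    then show ?thesis
      using trichotomy filterlim_at_top_imp_at_infinity filterlim_at_bot_imp_at_infinity by blast
  qed
  have "\<forall>\<^sub>F n :: nat in sequentially. q_seq q f (int n - 1) \<noteq> 0 \<and> q_ratio q \<nu> f (int n) > 0"
    if "recessive q f"
  proof -
    have "\<forall>\<^sub>F x in q_at_top q. f x * f (q * x) > 0"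
      using that by (auto simp: recessive_def elim!: eventually_mono)
    from eventually_q_seq_of_q_at_top[OF assms(1,2), where P = "\<lambda>x y z. y * z > 0", OF this]
    show ?thesis
      by eventually_elim (use assms(1) in \<open>auto simp: q_ratio_def zero_less_mult_iff zero_less_divide_iff mult_less_0_iff\<close>)
  qed
  then show ?thesis
    using trichotomy third recessive recessive_imp_q_ratio_tendsto_0[OF assms(1,2)]
      recessive_imp_gaussian_decay[OF assms(1,2)] by blast
qed

end
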